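(* Let $G$ be a finite simple undirected graph and let $f_1,f_2,\ldots,f_k$ ($k\ge 1$) be fixed monic polynomials in $\mathbb{F}_q[x]$, where $\mathbb{F}_q$ is a finite field. Then there exist a finite extension $\mathbb{F}_{q^m}$ of $\mathbb{F}_q$ and a monic polynomial $f\in\mathbb{F}_{q^m}[x]$ such that: (1) $f_i\mid f$ (and $f_i\neq f$) for all $1\le i\le k$; (2) $G$ is an induced subgraph of the gcd-graph $G_f(D)$, where $D=\{f_1,f_2,\ldots,f_k\}$ and $f$ and the $f_i$ are considered as elements of $\mathbb{F}_{q^m}[x]$.
   Context: For a finite field $F$, a nonzero monic $f\in F[x]$ and a set $D$ of monic divisors of $f$ with $f\notin D$, the gcd-graph $G_f(D)$ is the undirected loopless graph with vertex set the ring $F[x]/(f)$ in which two vertices $u,v$ are adjacent if and only if $\gcd(u-v,f)\in D$ (gcd's monic, $\gcd(0,f)=f$). "$G_1$ is an induced subgraph of $G_2$" means that there is an injective map $V(G_1)\to V(G_2)$ such that two vertices of $G_1$ are adjacent if and only if their images are adjacent in $G_2$. *)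

theory Defs
  imports
    "HOL-Algebra.Algebraic_Closure_Type"
    "Graph_Theory.Pair_Digraph"
begin

text \<open>
  A field is represented as a subset \<open>K\<close> of an ambient field type. This makes it possible to
  quantify over the finite extensions of a field \<open>'a\<close>: up to isomorphism they are the finite
  subfields of \<open>'a alg_closure\<close> that contain the image of \<open>'a\<close>.  Everything below that refers to
  the ring \<open>K[x]\<close> (divisibility, gcd, residue classes) is relative to \<open>K\<close>, not to the
  ambient field.
\<close>

definition polys_over :: "'b::field set \<Rightarrow> 'b poly set" where
  "polys_over K = {p. \<forall>i. Polynomial.coeff p i \<in> K}"

definition dvd_over :: "'b::field set \<Rightarrow> 'b poly \<Rightarrow> 'b poly \<Rightarrow> bool" where
  "dvd_over K p q \<longleftrightarrow> (\<exists>h\<in>polys_over K. q = p * h)"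

definition is_monic_gcd_over :: "'b::field set \<Rightarrow> 'b poly \<Rightarrow> 'b poly \<Rightarrow> 'b poly \<Rightarrow> bool" where
  "is_monic_gcd_over K g p q \<longleftrightarrow>
     g \<in> polys_over K \<and> Polynomial.lead_coeff g = 1 \<and> dvd_over K g p \<and> dvd_over K g q \<and>
     (\<forall>c\<in>polys_over K. dvd_over K c p \<longrightarrow> dvd_over K c q \<longrightarrow> dvd_over K c g)"

text \<open>The underlying set of \<open>K[x]/(f)\<close>, as a set of residue classes.\<close>

definition poly_residues :: "'b::field set \<Rightarrow> 'b poly \<Rightarrow> 'b poly set set" where
  "poly_residues K f =
     polys_over K // {(u, v). u \<in> polys_over K \<and> v \<in> polys_over K \<and> dvd_over K f (u - v)}"

text \<open>
  An undirected graph is a symmetric \<open>pair_pre_digraph\<close>, an edge being represented by its two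
  orientations. The gcd depends only on the residue classes of \<open>u\<close> and \<open>v\<close>, so
  it does not matter which representatives are chosen in the definition of adjacency.
  The definition is meant for a set \<open>D\<close> of monic divisors of \<open>f\<close> with \<open>f \<notin> D\<close>;
  the graph then has no loops because \<open>gcd(0, f) = f\<close>.
\<close>

definition gcd_graph :: "'b::field set \<Rightarrow> 'b poly \<Rightarrow> 'b poly set \<Rightarrow> 'b poly set pair_pre_digraph" where
  "gcd_graph K f D =
     \<lparr> pverts = poly_residues K f,
       parcs = {(U, V). U \<in> poly_residues K f \<and> V \<in> poly_residues K f \<and>
                        (\<exists>u\<in>U. \<exists>v\<in>V. \<exists>g\<in>D. is_monic_gcd_over K g (u - v) f)} \<rparr>"

text \<open>Induced subgraph up to isomorphism, i.e. via an injective map of the vertices.\<close>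

definition induced_subgraph_of :: "'v pair_pre_digraph \<Rightarrow> 'w pair_pre_digraph \<Rightarrow> bool" where
  "induced_subgraph_of G H \<longleftrightarrow>
     (\<exists>\<phi>. inj_on \<phi> (pverts G) \<and> \<phi> ` pverts G \<subseteq> pverts H \<and>
          (\<forall>u\<in>pverts G. \<forall>v\<in>pverts G. (u, v) \<in> parcs G \<longleftrightarrow> (\<phi> u, \<phi> v) \<in> parcs H))"

end

theory Submission
  imports Defs "HOL-Library.Cardinality"
begin

text \<open>
  Let \<open>a\<close> be a polynomial of largest degree in \<open>D\<close>.  If \<open>a\<close> divides both \<open>x\<close> and \<open>f\<close>, then
  \<open>gcd(x, f)\<close> lies in \<open>D\<close> exactly when it equals \<open>a\<close>, since every other multiple of \<open>a\<close> has a larger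
  degree than all members of \<open>D\<close> or is not monic.  So it suffices to realise the graph by polynomials
  \<open>w\<^sub>v\<close> and a polynomial \<open>h\<close> such that \<open>w\<^sub>u - w\<^sub>v\<close> is coprime to \<open>h\<close> exactly when \<open>u\<close> and \<open>v\<close> are
  adjacent; then \<open>f = a h\<close> and \<open>v \<mapsto> a w\<^sub>v\<close> do what is wanted.

  Let \<open>P\<close> be a non-constant polynomial that all members of \<open>D\<close> divide and label the vertices by field
  elements \<open>t\<^sub>v\<close>.  For \<open>w\<^sub>v = t\<^sub>v P + t\<^sub>v\<^sup>2\<close> one has
  \<open>w\<^sub>u - w\<^sub>v = (t\<^sub>u - t\<^sub>v) (P + t\<^sub>u + t\<^sub>v)\<close>,
  so up to units all differences are translates of \<open>P\<close>, and translates by different constants are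
  coprime.  Hence \<open>h\<close> can be the product of \<open>P\<close> and of the translates \<open>P + t\<^sub>u + t\<^sub>v\<close> that belong to the
  pairs of non-adjacent vertices, provided that the labels are distinct and the sums \<open>t\<^sub>u + t\<^sub>v\<close> over pairs of
  distinct vertices are non-zero and tell these pairs apart
  (\<open>weak_sidon_labelling_embeds_graph\<close>).  The factor \<open>P\<close> makes every member of \<open>D\<close> divide \<open>f\<close>, and it
  keeps the images of different vertices distinct modulo \<open>f\<close>.

  Labels of this kind can be chosen one after the other in every sufficiently large field
  (\<open>weak_sidon_subset_exists\<close>).  An extension of degree \<open>m\<close> of a field with \<open>q\<close> elements, \<open>m\<close> being
  arbitrary, is the set of the fixed points of \<open>x \<mapsto> x\<^bsup>q^m\<^esup>\<close> in the algebraic closure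
  (\<open>frobenius_fixed_field\<close>).
\<close>

section \<open>Finite subfields of the algebraic closure of a finite field\<close>

lemma finite_field_power_card:
  fixes x :: "'a::{field, finite}"
  shows "x ^ CARD('a) = x"
proof (cases "x = 0")
  case True
  then show ?thesis
    by (simp add: zero_power)
next
  case False
  let ?U = "UNIV - {0 :: 'a}"
  have "bij_betw ((*) x) ?U ?U"
    by (rule bij_betwI[of _ _ _ "\<lambda>y. y / x"]) (use False in auto)
  then have "(\<Prod>y\<in>?U. y) = (\<Prod>y\<in>?U. x * y)"
    by (rule prod.reindex_bij_betw[symmetric])
  also have "\<dots> = x ^ card ?U * (\<Prod>y\<in>?U. y)"
    by (simp add: prod.distrib)
  finally have "x ^ card ?U = 1"
    by simp
  moreover have "CARD('a) = Suc (card ?U)"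
    by (rule card.remove) auto
  ultimately show ?thesis
    by (simp only: power_Suc mult_1_right)
qed

lemma finite_field_card_gt_1: "CARD('a::{field, finite}) > 1"
proof -
  have "card {0, 1 :: 'a} \<le> CARD('a)"
    by (intro card_mono) auto
  then show ?thesis by simp
qed

text \<open>
  Both \<open>(X + 1)\<^sup>q\<close> and \<open>X\<^sup>q + 1\<close> take the value \<open>x + 1\<close> at every element \<open>x\<close> of a field with \<open>q\<close> elements,
  and the degree of their difference is less than \<open>q\<close>; so they have the same coefficients.  By
  the binomial theorem this makes the \<open>q\<close>-th power map additive on every extension field.
\<close>
lemma finite_field_of_nat_choose_card:
  assumes "0 < i" "i < CARD('a)"
  shows "of_nat (CARD('a) choose i) = (0 :: 'a::{field, finite})"
proof -
  let ?q = "CARD('a)"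
  define p :: "'a poly" where "p = [:1, 1:] ^ ?q - Polynomial.monom 1 ?q - 1"
  have coeff_p: "Polynomial.coeff p j = of_nat (?q choose j) - (if j = ?q then 1 else 0) - (if j = 0 then 1 else 0)" for j
  proof -
    have "Polynomial.coeff ([:1, 1:] ^ ?q :: 'a poly) j = of_nat (?q choose j)"
    proof (cases "j \<le> ?q")
      case True
      then show ?thesis using coeff_linear_poly_power[of j ?q 1 "1::'a"] by simp
    next
      case False
      then show ?thesis
        by (simp add: coeff_eq_0 degree_linear_power binomial_eq_0)
    qed
    then show ?thesis by (simp add: p_def)
  qed
  have "p = 0"
  proof (rule ccontr)
    assume "p \<noteq> 0"
    have "poly p x = 0" for x
      by (simp add: p_def poly_monom finite_field_power_card add.commute)
    then have "{x. poly p x = 0} = UNIV"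
      by simp
    moreover have "card {x. poly p x = 0} \<le> Polynomial.degree p"
      by (rule card_poly_roots_bound) (use \<open>p \<noteq> 0\<close> in auto)
    moreover have "Polynomial.degree p \<le> ?q - 1"
    proof (rule degree_le, intro allI impI)
      fix j assume "?q - 1 < j"
      then show "Polynomial.coeff p j = 0"
        using finite_field_card_gt_1[where 'a='a]
        by (cases "j = ?q") (auto simp: coeff_p binomial_eq_0)
    qed
    ultimately show False
      using finite_field_card_gt_1[where 'a='a] by simp
  qed
  then show ?thesis
    using coeff_p[of i] assms by simp
qed

lemma frobenius_additive:
  fixes x y :: "'a::{field, finite} alg_closure"
  shows "(x + y) ^ (CARD('a) ^ m) = x ^ (CARD('a) ^ m) + y ^ (CARD('a) ^ m)"
proof (induction m)
  case (Suc m)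
  let ?q = "CARD('a)"
  have additive: "(u + v) ^ ?q = u ^ ?q + v ^ ?q" for u v :: "'a alg_closure"
  proof -
    have "(u + v) ^ ?q = (\<Sum>k\<le>?q. of_nat (?q choose k) * u ^ k * v ^ (?q - k))"
      by (rule binomial_ring)
    also have "\<dots> = (\<Sum>k\<in>{0, ?q}. of_nat (?q choose k) * u ^ k * v ^ (?q - k))"
    proof (intro sum.mono_neutral_right ballI)
      fix k assume "k \<in> {..?q} - {0, ?q}"
      then have "of_nat (?q choose k) = (0 :: 'a)"
        by (intro finite_field_of_nat_choose_card) auto
      then have "of_nat (?q choose k) = (0 :: 'a alg_closure)"
        by (metis to_ac_0 to_ac_of_nat)
      then show "of_nat (?q choose k) * u ^ k * v ^ (?q - k) = 0"
        by simp
    qed auto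
    finally show ?thesis
      by (simp add: add.commute)
  qed
  show ?case
    using Suc by (simp add: power_mult additive mult.commute[of ?q])
qed simp

definition frobenius_fixed_field :: "nat \<Rightarrow> 'a::{field, finite} alg_closure set" where
  "frobenius_fixed_field m = {x. x ^ (CARD('a) ^ m) = x}"

lemma range_to_ac_subset_frobenius_fixed_field:
  "range to_ac \<subseteq> (frobenius_fixed_field m :: 'a::{field, finite} alg_closure set)"
proof -
  have "(x :: 'a) ^ (CARD('a) ^ m) = x" for x
    by (induction m) (simp_all add: power_mult finite_field_power_card)
  then show ?thesis
    by (auto simp: frobenius_fixed_field_def simp flip: to_ac_power)
qed

lemma ring_of_type_algebra_ops:
  fixes x y :: "'b::field"
  defines "R \<equiv> ring_of_type_algebra :: 'b ring"
  shows "carrier R = UNIV" "\<zero>\<^bsub>R\<^esub> = 0" "\<one>\<^bsub>R\<^esub> = 1" "x \<oplus>\<^bsub>R\<^esub> y = x + y" "x \<otimes>\<^bsub>R\<^esub> y = x * y"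
    and "\<ominus>\<^bsub>R\<^esub> x = - x" and "x \<noteq> 0 \<Longrightarrow> inv\<^bsub>R\<^esub> x = inverse x"
proof -
  interpret R: field R
    unfolding R_def by (rule field_from_type_algebra)
  show R: "carrier R = UNIV" "\<zero>\<^bsub>R\<^esub> = 0" "\<one>\<^bsub>R\<^esub> = 1"
    and ops: "x \<oplus>\<^bsub>R\<^esub> y = x + y" "x \<otimes>\<^bsub>R\<^esub> y = x * y" for x y
    by (simp_all add: R_def ring_of_type_algebra_def)
  show "\<ominus>\<^bsub>R\<^esub> x = - x"
    using R.minus_equality[of "- x" x] by (simp add: R ops)
  show "inv\<^bsub>R\<^esub> x = inverse x" if "x \<noteq> 0"
    using R.comm_inv_char[of x "inverse x"] that by (simp add: R ops)
qed

lemma subfield_ring_of_type_algebraI: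
  fixes K :: "'b::field set"
  assumes "1 \<in> K" "\<And>x. x \<in> K \<Longrightarrow> - x \<in> K" "\<And>x y. x \<in> K \<Longrightarrow> y \<in> K \<Longrightarrow> x + y \<in> K"
    and "\<And>x y. x \<in> K \<Longrightarrow> y \<in> K \<Longrightarrow> x * y \<in> K" "\<And>x. x \<in> K \<Longrightarrow> x \<noteq> 0 \<Longrightarrow> inverse x \<in> K"
  shows "subfield K ring_of_type_algebra"
proof -
  interpret R: field "ring_of_type_algebra :: 'b ring"
    by (rule field_from_type_algebra)
  show ?thesis
    using assms by (intro R.subfieldI' R.subringI) (auto simp: ring_of_type_algebra_ops)
qed

lemma subfield_frobenius_fixed_field:
  "subfield (frobenius_fixed_field m :: 'a::{field, finite} alg_closure set) ring_of_type_algebra"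
proof (rule subfield_ring_of_type_algebraI)
  let ?K = "frobenius_fixed_field m :: 'a alg_closure set"
  have add: "x + y \<in> ?K" and mult: "x * y \<in> ?K" if "x \<in> ?K" "y \<in> ?K" for x y
    using that by (auto simp: frobenius_fixed_field_def frobenius_additive power_mult_distrib)
  have "to_ac (- 1) \<in> ?K"
    using range_to_ac_subset_frobenius_fixed_field by blast
  then have "- 1 \<in> ?K"
    by simp
  then show "- x \<in> ?K" if "x \<in> ?K" for x
    using mult[OF _ that] by fastforce
  show "1 \<in> ?K" and "x \<in> ?K \<Longrightarrow> inverse x \<in> ?K" for x
    by (auto simp: frobenius_fixed_field_def power_inverse)
  show "x + y \<in> ?K" "x * y \<in> ?K" if "x \<in> ?K" "y \<in> ?K" for x y
    using add mult that by auto
qed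

text \<open>
  The polynomial \<open>X\<^bsup>q^m\<^esup> - X\<close> splits over the algebraic closure, and its roots are simple because its
  derivative is the constant \<open>- 1\<close>.
\<close>
lemma card_frobenius_fixed_field:
  assumes "m \<ge> 1"
  shows "finite (frobenius_fixed_field m :: 'a::{field, finite} alg_closure set)"
    and "card (frobenius_fixed_field m :: 'a alg_closure set) = CARD('a) ^ m"
proof -
  let ?K = "frobenius_fixed_field m :: 'a alg_closure set"
  define Q where "Q = CARD('a) ^ m"
  have "Q > 1"
    unfolding Q_def using finite_field_card_gt_1[where 'a='a] assms by (intro one_less_power) auto
  have "of_nat CARD('a) = (0 :: 'a)"
    using finite_field_of_nat_choose_card[of 1, where 'a='a] finite_field_card_gt_1[where 'a='a] by simp
  then have "of_nat CARD('a) = (0 :: 'a alg_closure)"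
    by (metis to_ac_0 to_ac_of_nat)
  then have Q0: "of_nat Q = (0 :: 'a alg_closure)"
    using assms by (simp add: Q_def zero_power)
  define p :: "'a alg_closure poly" where "p = Polynomial.monom 1 Q + [:0, - 1:]"
  have deg: "Polynomial.degree p = Q"
    using \<open>Q > 1\<close> unfolding p_def by (subst degree_add_eq_left) (auto simp: Polynomial.degree_monom_eq)
  have lead: "Polynomial.lead_coeff p = 1"
    unfolding deg using \<open>Q > 1\<close> by (simp add: p_def coeff_pCons split: nat.splits)
  have deriv: "pderiv p = [:- 1:]"
    by (simp add: p_def pderiv_add pderiv_monom Q0 pderiv_pCons)
  have root: "poly p x = 0 \<longleftrightarrow> x \<in> ?K" for x
    by (simp add: p_def poly_monom frobenius_fixed_field_def Q_def)
  have "p \<noteq> 0"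
    using lead by auto
  then obtain A where A: "size A = Q" "p = (\<Prod>x\<in>#A. [:- x, 1:])"
    using alg_closed_imp_factorization[of p] lead deg by auto
  have set_A: "set_mset A = ?K"
  proof -
    have "poly p x = 0 \<longleftrightarrow> x \<in># A" for x
      unfolding A(2) poly_prod_mset by (auto simp: prod_mset_zero_iff)
    then show ?thesis
      using root by auto
  qed
  have "count A x \<le> 1" for x
  proof (rule ccontr)
    assume "\<not> count A x \<le> 1"
    then have "{#x, x#} \<subseteq># A"
      by (auto simp: subseteq_mset_def)
    then obtain B where "A = {#x, x#} + B"
      by (metis subset_mset.add_diff_inverse)
    then have "p = [:- x, 1:] * ([:- x, 1:] * (\<Prod>y\<in>#B. [:- y, 1:]))"
      unfolding A(2) by (simp add: mult_ac)
    then have "poly (pderiv p) x = 0"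
      by (simp add: pderiv_mult del: mult_pCons_left mult_pCons_right)
    then show False
      by (simp add: deriv)
  qed
  then have "A = mset_set ?K"
    unfolding set_A[symmetric] by (intro multiset_eqI) (metis One_nat_def count_eq_zero_iff count_mset_set(1,3) finite_set_mset le_Suc_eq le_zero_eq)
  then show "card ?K = CARD('a) ^ m"
    using A(1) Q_def by simp
  show "finite ?K"
    unfolding set_A[symmetric] by simp
qed

section \<open>Sets with distinct pair sums\<close>

text \<open>
  A Sidon set proper would also demand that the sums \<open>a + a\<close> are distinct from each other and from the
  remaining ones, but in characteristic 2 every sum \<open>a + a\<close> vanishes.
\<close>
definition weak_sidon :: "'b::ab_group_add set \<Rightarrow> bool" where
  "weak_sidon T \<longleftrightarrow> (\<forall>a\<in>T. \<forall>b\<in>T. \<forall>c\<in>T. \<forall>d\<in>T.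
     a \<noteq> b \<longrightarrow> c \<noteq> d \<longrightarrow> a + b = c + d \<longrightarrow> {a, b} = {c, d})"

lemma weak_sidonD:
  "weak_sidon T \<Longrightarrow> a \<in> T \<Longrightarrow> b \<in> T \<Longrightarrow> c \<in> T \<Longrightarrow> d \<in> T \<Longrightarrow> a \<noteq> b \<Longrightarrow> c \<noteq> d \<Longrightarrow>
    a + b = c + d \<Longrightarrow> {a, b} = {c, d}"
  unfolding weak_sidon_def by blast

lemma weak_sidon_insert:
  assumes T: "weak_sidon T" and s: "\<And>a b c. a \<in> T \<Longrightarrow> b \<in> T \<Longrightarrow> c \<in> T \<Longrightarrow> s \<noteq> a + b - c"
  shows "weak_sidon (insert s T)"
proof -
  have *: "s + a \<noteq> b + c" if "a \<in> T" "b \<in> T" "c \<in> T" for a b c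
    using s[of b c a] that by (auto simp: algebra_simps)
  have **: "b + c \<noteq> s + a" "a + s \<noteq> b + c" "b + c \<noteq> a + s" if "a \<in> T" "b \<in> T" "c \<in> T" for a b c
    using *[OF that] by (auto simp: add.commute)
  show ?thesis
    unfolding weak_sidon_def
  proof (intro ballI impI)
    fix a b c d
    assume "a \<in> insert s T" "b \<in> insert s T" "c \<in> insert s T" "d \<in> insert s T"
      and "a \<noteq> b" "c \<noteq> d" "a + b = c + d"
    then show "{a, b} = {c, d}"
      using * ** weak_sidonD[OF T, of a b c d] by (auto simp: add.commute)
  qed
qed

text \<open>
  Greedy choice: at most \<open>n\<^sup>3 + n\<close> elements are unsuitable for extending a set of \<open>n\<close> elements, namely
  those of the form \<open>a + b - c\<close> or \<open>- a\<close>.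
\<close>
lemma weak_sidon_subset_exists:
  fixes K :: "'b::ab_group_add set"
  assumes "finite K" "n ^ 3 + n < card K"
  shows "\<exists>T\<subseteq>K. card T = n \<and> finite T \<and> weak_sidon T \<and> (\<forall>a\<in>T. \<forall>b\<in>T. a \<noteq> b \<longrightarrow> a + b \<noteq> 0)"
  using assms(2)
proof (induction n)
  case 0
  then show ?case
    by (intro exI[of _ "{}"]) (auto simp: weak_sidon_def)
next
  case (Suc n)
  have mono: "n ^ 3 + n \<le> Suc n ^ 3 + Suc n"
    by (intro add_mono power_mono) auto
  then obtain T where T: "T \<subseteq> K" "card T = n" "finite T" "weak_sidon T"
      "\<And>a b. a \<in> T \<Longrightarrow> b \<in> T \<Longrightarrow> a \<noteq> b \<Longrightarrow> a + b \<noteq> 0"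
    using Suc by force
  define Z where "Z = (\<lambda>(a, b, c). a + b - c) ` (T \<times> T \<times> T) \<union> uminus ` T"
  have "card Z \<le> card ((\<lambda>(a, b, c). a + b - c) ` (T \<times> T \<times> T)) + card (uminus ` T)"
    unfolding Z_def by (rule card_Un_le)
  also have "\<dots> \<le> card (T \<times> T \<times> T) + card T"
    using T by (intro add_mono card_image_le) auto
  also have "\<dots> = n ^ 3 + n"
    using T by (simp add: card_cartesian_product power3_eq_cube)
  also have "\<dots> < card K"
    using mono Suc.prems by linarith
  finally have "\<not> K \<subseteq> Z"
    using T by (metis Z_def card_mono finite_SigmaI finite_UnI finite_imageI leD)
  then obtain s where s: "s \<in> K" "s \<notin> Z"
    by blast
  have s1: "s \<noteq> a + b - c" if "a \<in> T" "b \<in> T" "c \<in> T" for a b c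
    using s that by (force simp: Z_def)
  have s2: "s \<noteq> - a" if "a \<in> T" for a
    using s that by (auto simp: Z_def)
  have s3: "- s \<notin> T"
    using s2 by force
  (* the case a = b = c of the excluded elements a + b - c *)
  have "s \<notin> T"
    using s1[of s s s] by auto
  moreover have "\<forall>a\<in>insert s T. \<forall>b\<in>insert s T. a \<noteq> b \<longrightarrow> a + b \<noteq> 0"
    using T(5) s2 s3 by (auto simp: add_eq_0_iff add_eq_0_iff2)
  ultimately show ?case
    using T s(1) weak_sidon_insert[OF T(4) s1] by (intro exI[of _ "insert s T"]) auto
qed

section \<open>Polynomials over a subfield\<close>

context
  fixes K :: "'b::field set"
  assumes K: "subfield K ring_of_type_algebra"
begin

lemma subfield_closed:
  shows "0 \<in> K" "1 \<in> K" "x \<in> K \<Longrightarrow> - x \<in> K" "x \<in> K \<Longrightarrow> y \<in> K \<Longrightarrow> x + y \<in> K"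
    "x \<in> K \<Longrightarrow> y \<in> K \<Longrightarrow> x * y \<in> K" "x \<in> K \<Longrightarrow> y \<in> K \<Longrightarrow> x - y \<in> K" "x \<in> K \<Longrightarrow> inverse x \<in> K"
proof -
  interpret R: field "ring_of_type_algebra :: 'b ring"
    by (rule field_from_type_algebra)
  note * = subdomainE[OF subfield.axioms(1)[OF K], unfolded ring_of_type_algebra_ops]
  show 0: "0 \<in> K" and "1 \<in> K" and m: "\<And>x. x \<in> K \<Longrightarrow> - x \<in> K"
    and a: "\<And>x y. x \<in> K \<Longrightarrow> y \<in> K \<Longrightarrow> x + y \<in> K" and "x \<in> K \<Longrightarrow> y \<in> K \<Longrightarrow> x * y \<in> K"
    using * by auto
  show "x \<in> K \<Longrightarrow> y \<in> K \<Longrightarrow> x - y \<in> K"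
    using a[of x "- y"] m by simp
  show "x \<in> K \<Longrightarrow> inverse x \<in> K"
    using R.subfield_m_inv(1)[OF K, of x] 0 by (cases "x = 0") (auto simp: ring_of_type_algebra_ops)
qed

lemma subfield_sum_closed: "(\<And>i. i \<in> A \<Longrightarrow> g i \<in> K) \<Longrightarrow> sum g A \<in> K"
  by (induction A rule: infinite_finite_induct) (auto intro: subfield_closed)

lemma polys_over_closed:
  shows "0 \<in> polys_over K" "1 \<in> polys_over K" "c \<in> K \<Longrightarrow> [:c:] \<in> polys_over K" "[:0, 1:] \<in> polys_over K"
    and "p \<in> polys_over K \<Longrightarrow> - p \<in> polys_over K"
    and "p \<in> polys_over K \<Longrightarrow> q \<in> polys_over K \<Longrightarrow> p + q \<in> polys_over K"
    and "p \<in> polys_over K \<Longrightarrow> q \<in> polys_over K \<Longrightarrow> p - q \<in> polys_over K"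
    and "p \<in> polys_over K \<Longrightarrow> q \<in> polys_over K \<Longrightarrow> p * q \<in> polys_over K"
  by (auto simp: polys_over_def coeff_pCons coeff_mult intro!: subfield_closed subfield_sum_closed
      split: nat.splits)

lemma polys_over_prod: "(\<And>i. i \<in> A \<Longrightarrow> g i \<in> polys_over K) \<Longrightarrow> prod g A \<in> polys_over K"
  by (induction A rule: infinite_finite_induct) (auto intro: polys_over_closed)

lemma dvd_overI: "h \<in> polys_over K \<Longrightarrow> q = p * h \<Longrightarrow> dvd_over K p q"
  unfolding dvd_over_def by blast

lemma dvd_over_refl: "dvd_over K p p"
  by (rule dvd_overI[of 1]) (auto intro: polys_over_closed)

lemma dvd_over_zero: "dvd_over K p 0"
  by (rule dvd_overI[of 0]) (auto intro: polys_over_closed)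

lemma dvd_over_trans: "dvd_over K p q \<Longrightarrow> dvd_over K q r \<Longrightarrow> dvd_over K p r"
  unfolding dvd_over_def by (metis mult.assoc polys_over_closed(8))

lemma dvd_over_mult: "dvd_over K p q \<Longrightarrow> h \<in> polys_over K \<Longrightarrow> dvd_over K p (q * h)"
  unfolding dvd_over_def by (metis mult.assoc polys_over_closed(8))

lemma dvd_over_mult_cancel_left: "dvd_over K p q \<Longrightarrow> dvd_over K (r * p) (r * q)"
  unfolding dvd_over_def by (metis mult.assoc)

lemma dvd_over_add: "dvd_over K p q \<Longrightarrow> dvd_over K p r \<Longrightarrow> dvd_over K p (q + r)"
  unfolding dvd_over_def by (metis distrib_left polys_over_closed(6))

lemma dvd_over_diff: "dvd_over K p q \<Longrightarrow> dvd_over K p r \<Longrightarrow> dvd_over K p (q - r)"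
  unfolding dvd_over_def by (metis right_diff_distrib polys_over_closed(7))

lemma dvd_over_imp_dvd: "dvd_over K p q \<Longrightarrow> p dvd q"
  unfolding dvd_over_def by auto

lemma dvd_over_prod:
  assumes "finite A" "i \<in> A" "\<And>i. i \<in> A \<Longrightarrow> g i \<in> polys_over K"
  shows "dvd_over K (g i) (prod g A)"
  using assms by (intro dvd_overI[of "prod g (A - {i})"] polys_over_prod) (auto simp: prod.remove)

section \<open>Pencils of translates of one polynomial\<close>

text \<open>Modulo \<open>P + \<alpha>\<close>, every factor \<open>P + \<beta>\<close> is the constant \<open>\<beta> - \<alpha>\<close>.\<close>
lemma translate_dvd_prod_translates_minus_const:
  assumes P: "P \<in> polys_over K" and "\<alpha> \<in> K" "B \<subseteq> K"
  shows "dvd_over K (P + [:\<alpha>:]) ((\<Prod>\<beta>\<in>B. P + [:\<beta>:]) - [:\<Prod>\<beta>\<in>B. \<beta> - \<alpha>:])"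
  using \<open>B \<subseteq> K\<close>
proof (induction B rule: infinite_finite_induct)
  case (insert \<beta> B)
  let ?h = "\<Prod>\<beta>\<in>B. P + [:\<beta>:]" and ?c = "\<Prod>\<beta>\<in>B. \<beta> - \<alpha>"
  have in_K: "[:\<beta> - \<alpha>:] \<in> polys_over K" "?h \<in> polys_over K"
    using insert.prems assms by (auto intro!: polys_over_closed subfield_closed polys_over_prod)
  have step: "(\<Prod>\<beta>\<in>insert \<beta> B. P + [:\<beta>:]) - [:\<Prod>\<beta>\<in>insert \<beta> B. \<beta> - \<alpha>:] =
      (P + [:\<alpha>:]) * ?h + (?h - [:?c:]) * [:\<beta> - \<alpha>:]"
  proof -
    have "P + [:\<beta>:] = (P + [:\<alpha>:]) + [:\<beta> - \<alpha>:]"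
      by simp
    then show ?thesis
      using insert.hyps by (simp add: algebra_simps smult_diff_left)
  qed
  show ?case
    unfolding step using insert in_K by (intro dvd_over_add dvd_over_mult dvd_over_refl) auto
qed (auto simp: dvd_over_zero simp flip: one_pCons)

text \<open>
  Since \<open>\<gamma> = (\<Prod>\<beta>\<in>B. \<beta> - \<alpha>)\<close> is a unit, the preceding congruence is a Bezout relation between \<open>P + \<alpha>\<close> and
  the product.  It is stated in the form needed to recognise \<open>a\<close> as a gcd of multiples of \<open>a\<close>.
\<close>
lemma translate_coprime_prod_translates:
  assumes P: "P \<in> polys_over K" and \<alpha>: "\<alpha> \<in> K" "\<alpha> \<notin> B" and B: "B \<subseteq> K" "finite B" and a: "a \<in> polys_over K"
    and c: "dvd_over K c (a * (P + [:\<alpha>:]))" "dvd_over K c (a * (\<Prod>\<beta>\<in>B. P + [:\<beta>:]))"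
  shows "dvd_over K c a"
proof -
  let ?h = "\<Prod>\<beta>\<in>B. P + [:\<beta>:]"
  define \<gamma> where "\<gamma> = (\<Prod>\<beta>\<in>B. \<beta> - \<alpha>)"
  have "\<gamma> \<noteq> 0"
    using \<alpha> B by (auto simp: \<gamma>_def)
  have "\<gamma> \<in> K"
    unfolding \<gamma>_def using B(2,1) \<alpha>(1)
    by (induction B rule: finite_induct) (auto intro: subfield_closed)
  obtain s where s: "s \<in> polys_over K" "?h - [:\<gamma>:] = (P + [:\<alpha>:]) * s"
    using translate_dvd_prod_translates_minus_const[OF P \<alpha>(1) B(1)] unfolding dvd_over_def \<gamma>_def by auto
  have "dvd_over K c (a * ?h - a * (P + [:\<alpha>:]) * s)"
    by (rule dvd_over_diff[OF c(2) dvd_over_mult[OF c(1) s(1)]])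
  also have "a * ?h - a * (P + [:\<alpha>:]) * s = a * [:\<gamma>:]"
    using s(2) by (simp add: algebra_simps)
  finally have "dvd_over K c (a * [:\<gamma>:] * [:inverse \<gamma>:])"
    by (rule dvd_over_mult) (use \<open>\<gamma> \<in> K\<close> in \<open>auto intro: polys_over_closed subfield_closed\<close>)
  then show ?thesis
    using \<open>\<gamma> \<noteq> 0\<close> by simp
qed

section \<open>Embedding a graph by means of a weak Sidon set\<close>

lemma poly_residues_memI: "x \<in> polys_over K \<Longrightarrow>
   {(u, v). u \<in> polys_over K \<and> v \<in> polys_over K \<and> dvd_over K f (u - v)} `` {x} \<in> poly_residues K f"
  unfolding poly_residues_def by (rule quotientI)

text \<open>
  For adjacent vertices \<open>u\<close> and \<open>v\<close> the constant \<open>t u + t v\<close> is not in \<open>B\<close>, so that \<open>P + t u + t v\<close> is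
  coprime to \<open>h\<close> and the gcd is \<open>a \<in> D\<close>.  For any other pair, including \<open>u = v\<close>, some
  \<open>a (P + \<beta>)\<close> divides the gcd, whose degree then exceeds that of every member of \<open>D\<close>.
\<close>
lemma weak_sidon_labelling_embeds_graph:
  fixes G :: "'v pair_pre_digraph"
  assumes G: "pair_graph G"
    and D: "finite D" "D \<noteq> {}" "D \<subseteq> polys_over K" "\<And>g. g \<in> D \<Longrightarrow> Polynomial.lead_coeff g = 1"
    and t: "inj_on t (pverts G)" "t ` pverts G \<subseteq> K" "weak_sidon (t ` pverts G)"
      "\<And>u v. u \<in> pverts G \<Longrightarrow> v \<in> pverts G \<Longrightarrow> u \<noteq> v \<Longrightarrow> t u + t v \<noteq> 0"
  shows "\<exists>f\<in>polys_over K. Polynomial.lead_coeff f = 1 \<and> (\<forall>g\<in>D. dvd_over K g f \<and> g \<noteq> f) \<and>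
           induced_subgraph_of G (gcd_graph K f D)"
proof -
  let ?V = "pverts G"
  interpret G: pair_graph G by fact
  have "finite ?V"
    by (rule G.pair_finite_verts)
  have sym: "(v, u) \<in> parcs G" if "(u, v) \<in> parcs G" for u v
    using G.pair_sym_arcs that by (auto simp: symmetric_def sym_def)
  have loopfree: "(u, u) \<notin> parcs G" for u
    using G.pair_no_loops by fastforce
  define d where "d = Max (Polynomial.degree ` D)"
  have "d \<in> Polynomial.degree ` D"
    unfolding d_def using D by (intro Max_in) auto
  then obtain a where a: "a \<in> D" "Polynomial.degree a = d"
    by auto
  have deg_D: "Polynomial.degree g \<le> Polynomial.degree a" if "g \<in> D" for g
    using that D a(2) by (simp add: d_def)
  have aK: "a \<in> polys_over K" and [simp]: "a \<noteq> 0" and lead_a: "Polynomial.lead_coeff a = 1"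
    using a D by force+

  (* the factor X makes P non-constant even if D = {1} *)
  define P where "P = [:0, 1:] * (\<Prod>g\<in>D. g)"
  have PK: "P \<in> polys_over K"
    unfolding P_def using D by (intro polys_over_closed(4,8) polys_over_prod) auto
  have lead_P: "Polynomial.lead_coeff P = 1"
    unfolding P_def lead_coeff_mult lead_coeff_prod using D by simp
  have deg_P: "Polynomial.degree P \<ge> 1"
  proof -
    have "(\<Prod>g\<in>D. g) \<noteq> 0"
      using D(1,4) by force
    then show ?thesis
      unfolding P_def by (subst degree_mult_eq) auto
  qed
  have translate: "Polynomial.degree (P + [:\<beta>:]) = Polynomial.degree P"
    "Polynomial.lead_coeff (P + [:\<beta>:]) = 1" "P + [:\<beta>:] \<noteq> 0" for \<beta>
  proof -
    show 1: "Polynomial.degree (P + [:\<beta>:]) = Polynomial.degree P"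
      using deg_P by (intro degree_add_eq_left) simp
    show "Polynomial.lead_coeff (P + [:\<beta>:]) = 1"
      unfolding 1 using lead_P deg_P by (auto simp: coeff_pCons split: nat.splits)
    then show "P + [:\<beta>:] \<noteq> 0"
      by force
  qed

  define B where "B = insert 0 {t u + t v | u v. u \<in> ?V \<and> v \<in> ?V \<and> u \<noteq> v \<and> (u, v) \<notin> parcs G}"
  have "B \<subseteq> insert 0 ((\<lambda>(u, v). t u + t v) ` (?V \<times> ?V))"
    by (auto simp: B_def)
  then have "finite B"
    by (rule finite_subset) (use \<open>finite ?V\<close> in simp)
  have "B \<subseteq> K"
    using t(2) by (auto simp: B_def intro!: subfield_closed)
  have nonarc_iff: "t u + t v \<in> B \<longleftrightarrow> (u, v) \<notin> parcs G" if uv: "u \<in> ?V" "v \<in> ?V" "u \<noteq> v" for u v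
  proof
    assume "t u + t v \<in> B"
    then obtain x y where xy: "x \<in> ?V" "y \<in> ?V" "x \<noteq> y" "(x, y) \<notin> parcs G" "t u + t v = t x + t y"
      using t(4)[OF uv] by (auto simp: B_def)
    then have "{t u, t v} = {t x, t y}"
      using uv t(1) by (intro weak_sidonD[OF t(3)]) (auto simp: inj_on_def)
    then have "u = x \<and> v = y \<or> u = y \<and> v = x"
      using uv xy t(1) by (auto simp: doubleton_eq_iff inj_on_def)
    then show "(u, v) \<notin> parcs G"
      using xy sym by auto
  qed (use uv in \<open>auto simp: B_def\<close>)

  define h where "h = (\<Prod>\<beta>\<in>B. P + [:\<beta>:])"
  define f where "f = a * h"
  have hK: "h \<in> polys_over K"
    unfolding h_def using PK \<open>B \<subseteq> K\<close> by (auto intro!: polys_over_prod polys_over_closed)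
  have fK: "f \<in> polys_over K"
    unfolding f_def using aK hK by (rule polys_over_closed)
  have lead_f: "Polynomial.lead_coeff f = 1"
    unfolding f_def h_def lead_coeff_mult lead_coeff_prod by (simp only: lead_a translate(2) prod.neutral_const mult_1_left)
  have dvd_h: "dvd_over K (P + [:\<beta>:]) h" if "\<beta> \<in> B" for \<beta>
    unfolding h_def using PK that \<open>finite B\<close> \<open>B \<subseteq> K\<close>
    by (intro dvd_over_prod) (auto intro!: polys_over_closed)
  have dvd_f: "dvd_over K (a * (P + [:\<beta>:])) f" if "\<beta> \<in> B" for \<beta>
    unfolding f_def using dvd_h[OF that] by (rule dvd_over_mult_cancel_left)
  have "0 \<in> B"
    by (simp add: B_def)
  have too_big: "\<not> dvd_over K (a * (P + [:\<beta>:])) g" if "g \<in> D" for g \<beta>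
  proof
    assume "dvd_over K (a * (P + [:\<beta>:])) g"
    moreover have "g \<noteq> 0"
      using D(4)[OF that] by force
    ultimately have "Polynomial.degree (a * (P + [:\<beta>:])) \<le> Polynomial.degree g"
      by (intro dvd_imp_degree_le dvd_over_imp_dvd)
    then show False
      using deg_D[OF that] deg_P translate[of \<beta>] by (simp add: degree_mult_eq)
  qed
  have divisors: "dvd_over K g f \<and> g \<noteq> f" if g: "g \<in> D" for g
  proof
    have "dvd_over K g P"
      unfolding P_def using dvd_over_prod[OF D(1) g, of "\<lambda>g. g"] D(3)
      unfolding mult.commute[of "[:0, 1:]"] by (intro dvd_over_mult polys_over_closed(4)) auto
    also have "P = P + [:0:]"
      by simp
    finally show "dvd_over K g f"
      using dvd_h[OF \<open>0 \<in> B\<close>] aK unfolding f_def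
      by (subst mult.commute) (intro dvd_over_mult, auto intro: dvd_over_trans)
    show "g \<noteq> f"
      using too_big[OF g] dvd_f[OF \<open>0 \<in> B\<close>] by metis
  qed

  define x where "x u = a * (smult (t u) P + [:t u * t u:])" for u
  have x_diff: "x u - x v = a * (P + [:t u + t v:]) * [:t u - t v:]" for u v
    by (simp add: x_def algebra_simps smult_diff_left smult_add_left)
  have xK: "x u \<in> polys_over K" if "u \<in> ?V" for u
  proof -
    have "t u \<in> K"
      using t(2) that by auto
    then have "a * ([:t u:] * P + [:t u * t u:]) \<in> polys_over K"
      using aK PK by (intro polys_over_closed subfield_closed)
    then show ?thesis
      by (simp add: x_def)
  qed
  define R where "R = {(u, v). u \<in> polys_over K \<and> v \<in> polys_over K \<and> dvd_over K f (u - v)}"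
  define \<phi> where "\<phi> u = R `` {x u}" for u
  have \<phi>_mem: "\<phi> u \<in> poly_residues K f" if "u \<in> ?V" for u
    unfolding \<phi>_def R_def using xK[OF that] by (rule poly_residues_memI)
  have x_mem: "x u \<in> \<phi> u" if "u \<in> ?V" for u
    using xK[OF that] by (auto simp: \<phi>_def R_def dvd_over_zero)
  have \<phi>_dvd: "dvd_over K f (x u - w)" if "w \<in> \<phi> u" for u w
    using that by (auto simp: \<phi>_def R_def)

  have "inj_on \<phi> ?V"
  proof (rule inj_onI, rule ccontr)
    fix u v assume uv: "u \<in> ?V" "v \<in> ?V" "\<phi> u = \<phi> v" "u \<noteq> v"
    define \<gamma> where "\<gamma> = (t u + t v) * (t u - t v)"
    have "\<gamma> \<noteq> 0"
      using uv t by (auto simp: \<gamma>_def inj_on_def)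
    have "dvd_over K (a * (P + [:0:])) (x u - x v)"
      using \<phi>_dvd[of "x v" u] x_mem[of v] uv dvd_f[OF \<open>0 \<in> B\<close>] by (metis dvd_over_trans)
    then have "a * P dvd a * ((P + [:t u + t v:]) * [:t u - t v:])"
      unfolding x_diff mult.assoc by (auto dest: dvd_over_imp_dvd)
    then have "P dvd (P + [:t u + t v:]) * [:t u - t v:]"
      by (simp only: dvd_mult_cancel_left) simp
    moreover have "(P + [:t u + t v:]) * [:t u - t v:] = P * [:t u - t v:] + [:\<gamma>:]"
      by (simp add: \<gamma>_def algebra_simps)
    ultimately have "P dvd [:\<gamma>:]"
      by (metis dvd_add_right_iff dvd_triv_left)
    then have "Polynomial.degree P \<le> 0"
      using dvd_imp_degree_le[of P "[:\<gamma>:]"] \<open>\<gamma> \<noteq> 0\<close> by simp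
    then show False
      using deg_P by simp
  qed
  moreover have "(u, v) \<in> parcs G \<longleftrightarrow> (\<phi> u, \<phi> v) \<in> parcs (gcd_graph K f D)"
    if uv: "u \<in> ?V" "v \<in> ?V" for u v
  proof
    assume arc: "(u, v) \<in> parcs G"
    then have "u \<noteq> v"
      using loopfree by auto
    have \<alpha>: "t u + t v \<in> K" "t u + t v \<notin> B" "t u - t v \<in> K" "t u - t v \<noteq> 0"
      using uv t arc \<open>u \<noteq> v\<close> nonarc_iff by (auto intro!: subfield_closed simp: inj_on_def)
    have "is_monic_gcd_over K a (x u - x v) f"
      unfolding is_monic_gcd_over_def
    proof (intro conjI ballI impI)
      show "dvd_over K a (x u - x v)" "dvd_over K a f"
        unfolding x_diff f_def using \<alpha> PK hK
        by (auto intro!: dvd_over_mult dvd_over_refl polys_over_closed simp del: mult_pCons_right)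
    next
      fix c assume c: "dvd_over K c (x u - x v)" "dvd_over K c f"
      have "dvd_over K c ((x u - x v) * [:inverse (t u - t v):])"
        using c \<alpha> by (intro dvd_over_mult) (auto intro!: polys_over_closed subfield_closed)
      also have "(x u - x v) * [:inverse (t u - t v):] = a * (P + [:t u + t v:])"
        unfolding x_diff using \<alpha>(4) by simp
      finally show "dvd_over K c a"
        using c(2) translate_coprime_prod_translates[OF PK \<alpha>(1,2) \<open>B \<subseteq> K\<close> \<open>finite B\<close> aK, of c]
        by (simp only: f_def h_def)
    qed (use aK lead_a in auto)
    then show "(\<phi> u, \<phi> v) \<in> parcs (gcd_graph K f D)"
      using uv a(1) \<phi>_mem x_mem by (auto simp: gcd_graph_def)
  next
    assume "(\<phi> u, \<phi> v) \<in> parcs (gcd_graph K f D)"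
    then obtain u' v' g where g: "u' \<in> \<phi> u" "v' \<in> \<phi> v" "g \<in> D" "is_monic_gcd_over K g (u' - v') f"
      by (auto simp: gcd_graph_def)
    show "(u, v) \<in> parcs G"
    proof (rule ccontr)
      assume nonarc: "(u, v) \<notin> parcs G"
      obtain \<beta> where \<beta>: "\<beta> \<in> B" "dvd_over K (a * (P + [:\<beta>:])) (x u - x v)"
      proof (cases "u = v")
        case True
        then show ?thesis
          using that[OF \<open>0 \<in> B\<close>] by (simp add: dvd_over_zero)
      next
        case False
        have "[:t u - t v:] \<in> polys_over K"
          using uv t(2) by (auto intro!: polys_over_closed subfield_closed)
        then show ?thesis
          using that[of "t u + t v"] nonarc_iff[OF uv False] nonarc unfolding x_diff
          by (blast intro: dvd_over_mult dvd_over_refl)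
      qed
      let ?b = "a * (P + [:\<beta>:])"
      have b_f: "dvd_over K ?b f"
        using dvd_f \<beta>(1) .
      have "dvd_over K ?b ((x u - x v) - (x u - u') + (x v - v'))"
        by (rule dvd_over_add[OF dvd_over_diff[OF \<beta>(2)]];
            rule dvd_over_trans[OF b_f \<phi>_dvd]) (rule g)+
      also have "(x u - x v) - (x u - u') + (x v - v') = u' - v'"
        by simp
      finally have "dvd_over K ?b g"
        using g(4) b_f aK PK \<beta>(1) \<open>B \<subseteq> K\<close> unfolding is_monic_gcd_over_def
        by (auto intro!: polys_over_closed)
      then show False
        using too_big g(3) by blast
    qed
  qed
  ultimately have "induced_subgraph_of G (gcd_graph K f D)"
    unfolding induced_subgraph_of_def using \<phi>_mem
    by (intro exI[of _ \<phi>]) (auto simp: gcd_graph_def)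
  then show ?thesis
    using fK lead_f divisors by blast
qed

end

section \<open>Induced subgraphs of gcd-graphs\<close>

theorem proposition8p4:
  fixes G :: "'v pair_pre_digraph"
    and fs :: "nat \<Rightarrow> ('a :: {field, finite}) poly"
    and k :: nat
  assumes "pair_graph G"
    and "k \<ge> 1"
    and "\<And>i. i \<in> {1..k} \<Longrightarrow> Polynomial.lead_coeff (fs i) = 1"
  shows "\<exists>(m::nat) (K :: 'a alg_closure set) (f :: 'a alg_closure poly).
           m \<ge> 1 \<and> subfield K ring_of_type_algebra \<and> range to_ac \<subseteq> K \<and>
           finite K \<and> card K = card (UNIV :: 'a set) ^ m \<and>
           f \<in> polys_over K \<and> Polynomial.lead_coeff f = 1 \<and>
           (\<forall>i\<in>{1..k}. dvd_over K (map_poly to_ac (fs i)) f \<and> map_poly to_ac (fs i) \<noteq> f) \<and>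
           induced_subgraph_of G (gcd_graph K f ((\<lambda>i. map_poly to_ac (fs i)) ` {1..k}))"
proof -
  interpret G: pair_graph G by fact
  let ?n = "card (pverts G)"
  define m where "m = ?n ^ 3 + ?n + 1"
  define K where "K = (frobenius_fixed_field m :: 'a alg_closure set)"
  let ?D = "(\<lambda>i. map_poly to_ac (fs i)) ` {1..k}"
  have "m \<ge> 1"
    by (simp add: m_def)
  note card_K = card_frobenius_fixed_field[OF this, where 'a='a, folded K_def]
  have K: "subfield K ring_of_type_algebra" "range to_ac \<subseteq> K"
    unfolding K_def by (rule subfield_frobenius_fixed_field range_to_ac_subset_frobenius_fixed_field)+
  have "m < 2 ^ m"
    by (rule less_exp)
  also have "2 ^ m \<le> CARD('a) ^ m"
    using finite_field_card_gt_1[where 'a='a] by (intro power_mono) auto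
  finally have "?n ^ 3 + ?n < card K"
    by (simp add: card_K m_def)
  from weak_sidon_subset_exists[OF card_K(1) this] obtain T where
    T: "T \<subseteq> K" "card T = ?n" "finite T" "weak_sidon T" "\<forall>a\<in>T. \<forall>b\<in>T. a \<noteq> b \<longrightarrow> a + b \<noteq> 0"
    by auto
  obtain t where t: "bij_betw t (pverts G) T"
    using finite_same_card_bij[OF G.pair_finite_verts T(3)] T(2) by auto
  have inj: "inj_on t (pverts G)" and img: "t ` pverts G = T"
    using t by (auto simp: bij_betw_def)
  have D: "?D \<subseteq> polys_over K" "\<And>g. g \<in> ?D \<Longrightarrow> Polynomial.lead_coeff g = 1"
  proof -
    show "?D \<subseteq> polys_over K"
      using K(2) by (auto simp: polys_over_def coeff_map_poly)
    show "Polynomial.lead_coeff g = 1" if g: "g \<in> ?D" for g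
    proof -
      obtain i where i: "i \<in> {1..k}" "g = map_poly to_ac (fs i)"
        using g by auto
      then have "Polynomial.degree g = Polynomial.degree (fs i)"
        using assms(3)[of i] by (simp add: degree_map_poly)
      then show ?thesis
        using i assms(3)[of i] by (simp add: coeff_map_poly)
    qed
  qed
  have "\<exists>f\<in>polys_over K. Polynomial.lead_coeff f = 1 \<and> (\<forall>g\<in>?D. dvd_over K g f \<and> g \<noteq> f) \<and>
           induced_subgraph_of G (gcd_graph K f ?D)"
  proof (rule weak_sidon_labelling_embeds_graph[OF K(1) assms(1) _ _ D inj])
    show "t u + t v \<noteq> 0" if "u \<in> pverts G" "v \<in> pverts G" "u \<noteq> v" for u v
      using that T(5) inj img by (auto simp: inj_on_def)
  qed (use T img assms(2) in auto)
  then show ?thesis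
    using \<open>m \<ge> 1\<close> K card_K by (intro exI[of _ m] exI[of _ K]) auto
qed

end
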